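(* Let $X$ be a sequentially complete Hausdorff locally convex space over $\mathbb{C}$ and let $\mathcal{P}$ be a calibration on $X$. Then an operator $T\in Q_{\mathcal{P}}(X)$ is regular if and only if $T\in (Q_{\mathcal{P}}(X))_{0}$, i.e. if and only if $T$ is a bounded element of the algebra $Q_{\mathcal{P}}(X)$.
   Context: A calibration on a locally convex space $X$ is a family $\mathcal{P}$ of seminorms generating the topology of $X$ (the coarsest topology making all $p\in\mathcal{P}$ continuous). $Q_{\mathcal{P}}(X)$ is the algebra of quotient bounded operators: linear operators $T:X\to X$ such that for every $p\in\mathcal{P}$ there is $c_p>0$ with $p(Tx)\le c_p\,p(x)$ for all $x\in X$. For $p\in\mathcal{P}$ and $T\in Q_{\mathcal{P}}(X)$ put $\hat p(T)=\inf\{r>0 : p(Tx)\le r\,p(x)\ \forall x\in X\}$; $Q_{\mathcal{P}}(X)$ carries the topology generated by the submultiplicative seminorms $\hat p$, $p\in\mathcal{P}$, and "bounded set" refers to this topology. $T\in Q_{\mathcal{P}}(X)$ is a bounded element (in the sense of Allan) if some nonzero scalar multiple $\alpha T$ generates a bounded semigroup, i.e. $\{(\alpha T)^n : n\ge 1\}$ is bounded in $Q_{\mathcal{P}}(X)$. The set of bounded elements is denoted $(Q_{\mathcal{P}}(X))_0$. $T\in Q_{\mathcal{P}}(X)$ is regular (in the sense of Waelbroeck) if there is $t>0$ such that (1) $\lambda I-T$ is invertible in $Q_{\mathcal{P}}(X)$ for all $|\lambda|>t$, and (2) the set $\{R(\lambda,T) : |\lambda|>t\}$ is bounded in $Q_{\mathcal{P}}(X)$,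 where $R(\lambda,T)=(\lambda I-T)^{-1}$. *)

theory Defs
  imports "HOL-Analysis.Analysis" "HOL-Library.Function_Algebras"
begin

text \<open>The complex vector space is the whole type \<^typ>\<open>'a\<close> with an explicit scalar
  multiplication, and its topology is an explicit value of type \<^typ>\<open>'a topology\<close>.\<close>

definition linear_topology ::
    "(complex \<Rightarrow> 'a::ab_group_add \<Rightarrow> 'a) \<Rightarrow> 'a topology \<Rightarrow> bool" where
  "linear_topology scl \<tau> \<longleftrightarrow>
     vector_space scl \<and> topspace \<tau> = UNIV \<and>
     continuous_map (prod_topology \<tau> \<tau>) \<tau> (\<lambda>(x, y). x + y) \<and>
     continuous_map (prod_topology euclidean \<tau>) \<tau> (\<lambda>(c, x). scl c x)"

definition convex_wrt :: "(complex \<Rightarrow> 'a::ab_group_add \<Rightarrow> 'a) \<Rightarrow> 'a set \<Rightarrow> bool" where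
  "convex_wrt scl C \<longleftrightarrow>
     (\<forall>x\<in>C. \<forall>y\<in>C. \<forall>u v::real. u \<ge> 0 \<and> v \<ge> 0 \<and> u + v = 1 \<longrightarrow>
        scl (complex_of_real u) x + scl (complex_of_real v) y \<in> C)"

definition locally_convex_space ::
    "(complex \<Rightarrow> 'a::ab_group_add \<Rightarrow> 'a) \<Rightarrow> 'a topology \<Rightarrow> bool" where
  "locally_convex_space scl \<tau> \<longleftrightarrow>
     linear_topology scl \<tau> \<and>
     (\<forall>U. openin \<tau> U \<and> 0 \<in> U \<longrightarrow>
        (\<exists>C. openin \<tau> C \<and> 0 \<in> C \<and> C \<subseteq> U \<and> convex_wrt scl C))"

definition tvs_Cauchy :: "'a::ab_group_add topology \<Rightarrow> (nat \<Rightarrow> 'a) \<Rightarrow> bool" where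
  "tvs_Cauchy \<tau> s \<longleftrightarrow>
     (\<forall>U. openin \<tau> U \<and> 0 \<in> U \<longrightarrow> (\<exists>N. \<forall>m\<ge>N. \<forall>n\<ge>N. s m - s n \<in> U))"

definition sequentially_complete :: "'a::ab_group_add topology \<Rightarrow> bool" where
  "sequentially_complete \<tau> \<longleftrightarrow>
     (\<forall>s. tvs_Cauchy \<tau> s \<longrightarrow> (\<exists>l. limitin \<tau> s l sequentially))"

definition seminorm :: "(complex \<Rightarrow> 'a::ab_group_add \<Rightarrow> 'a) \<Rightarrow> ('a \<Rightarrow> real) \<Rightarrow> bool" where
  "seminorm scl p \<longleftrightarrow>
     (\<forall>x. p x \<ge> 0) \<and> (\<forall>x y. p (x + y) \<le> p x + p y) \<and>
     (\<forall>c x. p (scl c x) = cmod c * p x)"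

text \<open>The topology generated on \<open>V\<close> by the seminorms \<open>P\<close>: the open semi-balls form a subbase.
  ``The coarsest topology making all \<open>p \<in> P\<close> continuous'' has to be read among linear
  topologies, as the plain initial topology of the maps \<open>p\<close> is in general not translation invariant;
  see \<open>seminorm_topology_coarsest\<close> and \<open>continuous_map_seminorm\<close> below.
  \<open>V\<close> itself is added to the subbase so that the space is \<open>V\<close> also when \<open>P\<close> is empty.\<close>

definition seminorm_topology :: "'v::ab_group_add set \<Rightarrow> ('v \<Rightarrow> real) set \<Rightarrow> 'v topology" where
  "seminorm_topology V P =
     topology_generated_by
       (insert V {{y \<in> V. p (y - x) < e} | p x e. p \<in> P \<and> x \<in> V \<and> e > 0})"

lemma topspace_seminorm_topology [simp]: "topspace (seminorm_topology V P) = V"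
  by (auto simp: seminorm_topology_def topology_generated_by_topspace)

lemma continuous_map_seminorm:
  assumes "vector_space scl" "seminorm scl p" "p \<in> P"
  shows "continuous_map (seminorm_topology UNIV P) euclideanreal p"
proof -
  interpret vector_space scl by fact
  have sub: "p (x + y) \<le> p x + p y" for x y
    using assms(2) by (auto simp: seminorm_def)
  have "p (scl (-1) x) = cmod (-1) * p x" for x
    using assms(2) unfolding seminorm_def by blast
  then have neg: "p (- x) = p x" for x by simp
  have "openin (seminorm_topology UNIV P) {x. p x \<in> U}" if U: "open U" for U
  proof (subst openin_subopen, intro ballI)
    fix x assume x: "x \<in> {x. p x \<in> U}"
    then obtain e where e: "e > 0" "\<And>t. dist t (p x) < e \<Longrightarrow> t \<in> U"
      using U by (auto simp: open_dist)
    have "openin (seminorm_topology UNIV P) {y \<in> UNIV. p (y - x) < e}"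
      unfolding seminorm_topology_def
      by (rule topology_generated_by_Basis) (use assms(3) e(1) in auto)
    moreover have "x \<in> {y \<in> UNIV. p (y - x) < e}"
      using assms(2) e(1) by (auto simp: seminorm_def) (metis mult_zero_left norm_zero scale_zero_left)
    moreover have "{y \<in> UNIV. p (y - x) < e} \<subseteq> {x. p x \<in> U}"
    proof clarify
      fix y assume y: "p (y - x) < e"
      have "p y \<le> p (y - x) + p x" "p x \<le> p (x - y) + p y" "p (x - y) = p (y - x)"
        using sub[of "y - x" x] sub[of "x - y" y] neg[of "y - x"] by auto
      then show "p y \<in> U" using y by (intro e(2)) (auto simp: dist_real_def)
    qed
    ultimately show "\<exists>T. openin (seminorm_topology UNIV P) T \<and> x \<in> T \<and> T \<subseteq> {x. p x \<in> U}"
      by blast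
  qed
  then show ?thesis by (auto simp: continuous_map_def)
qed

lemma seminorm_topology_coarsest:
  assumes \<sigma>: "linear_topology scl \<sigma>"
    and P: "\<And>p. p \<in> P \<Longrightarrow> continuous_map \<sigma> euclideanreal p"
    and U: "openin (seminorm_topology UNIV P) U"
  shows "openin \<sigma> U"
proof -
  have top: "topspace \<sigma> = UNIV"
    and add: "continuous_map (prod_topology \<sigma> \<sigma>) \<sigma> (\<lambda>(x, y). x + y)"
    using \<sigma> by (auto simp: linear_topology_def)
  have ball: "openin \<sigma> {y \<in> UNIV. p (y - x) < e}" if "p \<in> P" for p x e
  proof -
    have "continuous_map \<sigma> (prod_topology \<sigma> \<sigma>) (\<lambda>y. (y, - x))"
      using top by (auto simp: continuous_map_pairedI)
    from continuous_map_compose[OF this add] have "continuous_map \<sigma> \<sigma> (\<lambda>y. y - x)"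
      by (simp add: o_def)
    from continuous_map_compose[OF this P[OF that]]
    have "continuous_map \<sigma> euclideanreal (\<lambda>y. p (y - x))" by (simp add: o_def)
    from openin_continuous_map_preimage[OF this, of "{..<e}"] show ?thesis
      by (simp add: top)
  qed
  have "generate_topology_on
          (insert UNIV {{y \<in> UNIV. p (y - x) < e} | p x e. p \<in> P \<and> x \<in> UNIV \<and> e > 0}) U"
    using U by (simp add: seminorm_topology_def openin_topology_generated_by_iff)
  then show ?thesis
  proof induction
    case (Basis S)
    then show ?case using ball top openin_topspace[of \<sigma>] by auto
  qed auto
qed

definition calibration ::
    "(complex \<Rightarrow> 'a::ab_group_add \<Rightarrow> 'a) \<Rightarrow> 'a topology \<Rightarrow> ('a \<Rightarrow> real) set \<Rightarrow> bool" where
  "calibration scl \<tau> P \<longleftrightarrow> (\<forall>p\<in>P. seminorm scl p) \<and> \<tau> = seminorm_topology UNIV P"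

text \<open>Bounded sets of a topological vector space: absorbed by every neighbourhood of zero.\<close>

definition tvs_bounded ::
    "(complex \<Rightarrow> 'v::ab_group_add \<Rightarrow> 'v) \<Rightarrow> 'v topology \<Rightarrow> 'v set \<Rightarrow> bool" where
  "tvs_bounded scl \<tau> B \<longleftrightarrow>
     B \<subseteq> topspace \<tau> \<and>
     (\<forall>U. openin \<tau> U \<and> 0 \<in> U \<longrightarrow>
        (\<exists>r>0. \<forall>c. cmod c \<ge> r \<longrightarrow> B \<subseteq> scl c ` U))"

definition quotient_bounded ::
    "(complex \<Rightarrow> 'a::ab_group_add \<Rightarrow> 'a) \<Rightarrow> ('a \<Rightarrow> real) set \<Rightarrow> ('a \<Rightarrow> 'a) set" where
  "quotient_bounded scl P =
     {T. Vector_Spaces.linear scl scl T \<and> (\<forall>p\<in>P. \<exists>c>0. \<forall>x. p (T x) \<le> c * p x)}"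

definition op_seminorm :: "('a \<Rightarrow> real) \<Rightarrow> ('a \<Rightarrow> 'a) \<Rightarrow> real" where
  "op_seminorm p T = Inf {r. r > 0 \<and> (\<forall>x. p (T x) \<le> r * p x)}"

definition op_scale :: "(complex \<Rightarrow> 'a \<Rightarrow> 'a) \<Rightarrow> complex \<Rightarrow> ('a \<Rightarrow> 'a) \<Rightarrow> 'a \<Rightarrow> 'a" where
  "op_scale scl c T = (\<lambda>x. scl c (T x))"

text \<open>Addition, zero and subtraction of operators are the pointwise ones of
  \<^theory>\<open>HOL-Library.Function_Algebras\<close>; the product in the algebra is composition, so powers are
  written \<open>^^\<close> (\<open>^\<close> on functions would be the pointwise power).\<close>

definition qb_topology ::
    "(complex \<Rightarrow> 'a::ab_group_add \<Rightarrow> 'a) \<Rightarrow> ('a \<Rightarrow> real) set \<Rightarrow> ('a \<Rightarrow> 'a) topology" where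
  "qb_topology scl P = seminorm_topology (quotient_bounded scl P) (op_seminorm ` P)"

definition qb_bounded ::
    "(complex \<Rightarrow> 'a::ab_group_add \<Rightarrow> 'a) \<Rightarrow> ('a \<Rightarrow> real) set \<Rightarrow> ('a \<Rightarrow> 'a) set \<Rightarrow> bool" where
  "qb_bounded scl P B \<longleftrightarrow> tvs_bounded (op_scale scl) (qb_topology scl P) B"

definition bounded_elements ::
    "(complex \<Rightarrow> 'a::ab_group_add \<Rightarrow> 'a) \<Rightarrow> ('a \<Rightarrow> real) set \<Rightarrow> ('a \<Rightarrow> 'a) set" where
  "bounded_elements scl P =
     {T \<in> quotient_bounded scl P.
        \<exists>\<alpha>. \<alpha> \<noteq> 0 \<and> qb_bounded scl P {op_scale scl \<alpha> T ^^ n | n. n \<ge> 1}}"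

definition qb_invertible ::
    "(complex \<Rightarrow> 'a::ab_group_add \<Rightarrow> 'a) \<Rightarrow> ('a \<Rightarrow> real) set \<Rightarrow> ('a \<Rightarrow> 'a) \<Rightarrow> bool" where
  "qb_invertible scl P T \<longleftrightarrow>
     T \<in> quotient_bounded scl P \<and>
     (\<exists>S\<in>quotient_bounded scl P. S \<circ> T = id \<and> T \<circ> S = id)"

definition resolvent ::
    "(complex \<Rightarrow> 'a::ab_group_add \<Rightarrow> 'a) \<Rightarrow> complex \<Rightarrow> ('a \<Rightarrow> 'a) \<Rightarrow> 'a \<Rightarrow> 'a" where
  "resolvent scl l T = inv (op_scale scl l id - T)"

definition regular_op ::
    "(complex \<Rightarrow> 'a::ab_group_add \<Rightarrow> 'a) \<Rightarrow> ('a \<Rightarrow> real) set \<Rightarrow> ('a \<Rightarrow> 'a) \<Rightarrow> bool" where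
  "regular_op scl P T \<longleftrightarrow>
     T \<in> quotient_bounded scl P \<and>
     (\<exists>t>0. (\<forall>l. cmod l > t \<longrightarrow> qb_invertible scl P (op_scale scl l id - T)) \<and>
            qb_bounded scl P {resolvent scl l T | l. cmod l > t})"

end

theory Submission
  imports Defs
begin

text \<open>Boundedness of a set of quotient bounded operators means that for every \<open>p \<in> P\<close> one constant
  \<open>M\<close> satisfies \<open>p (S x) \<le> M * p x\<close> for all operators \<open>S\<close> of the set (\<open>qb_bounded_iff\<close>). So \<open>T\<close> is
  a bounded element iff there is a single rate \<open>r\<close> with \<open>p (T\<^sup>n x) \<le> K r\<^sup>n p x\<close> for every \<open>p\<close>, where
  \<open>K\<close> may depend on \<open>p\<close> but \<open>r\<close> may not.

  From such a rate, the Neumann series \<open>\<Sum> T\<^sup>n x / l\<^sup>n\<^sup>+\<^sup>1\<close> with \<open>\<bar>l\<bar> > 2 r\<close> is dominated by a geometric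
  series in each seminorm. Sequential completeness gives its sum, the Hausdorff property identifies
  the sum as a resolvent, and the geometric bound is uniform in \<open>l\<close>
  (\<open>Neumann_resolvent\<close>).

  Conversely, let the resolvent be bounded for \<open>\<bar>l\<bar> > t\<close>. Every \<open>s > t\<close> turns out to be a rate. The
  classical reason is that \<open>T\<^sup>n\<close> is a Laurent coefficient of the resolvent, but a contour
  integral can be replaced by finite means, one seminorm at a time. By
  partial fractions, the mean of \<open>l R(l)\<close> over \<open>N\<close> equidistant points of the circle \<open>\<bar>l\<bar> = s\<close> is
  the inverse of \<open>I - (T/s)\<^sup>N\<close> (\<open>circle_mean_right_inverse\<close>). It is close to \<open>I\<close> exactly
  when \<open>(T/s)\<^sup>N\<close> is small. As \<open>l R(l)\<close> is Lipschitz on bounded annuli, the means over two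
  neighbouring circles are close to each other uniformly in \<open>N\<close>. Hence smallness of \<open>(T/s)\<^sup>N\<close>
  for large \<open>N\<close> passes from a radius to slightly smaller ones (\<open>dominated_shrink\<close>), by a
  step that can be chosen constant. It holds for large radii, since \<open>T\<close> itself is bounded with
  respect to \<open>p\<close>, and so finitely many steps reach any \<open>s > t\<close>
  (\<open>dominated_beyond_t\<close>). The number of steps depends on \<open>p\<close>, the final radius does not.\<close>

section \<open>Seminormed spaces\<close>

locale seminormed_space = vector_space scl
  for scl :: "complex \<Rightarrow> 'a::ab_group_add \<Rightarrow> 'a" +
  fixes p :: "'a \<Rightarrow> real"
  assumes seminorm: "seminorm scl p"
begin

lemma nonneg [simp]: "0 \<le> p x"
  and triangle: "p (x + y) \<le> p x + p y"
  and scaled [simp]: "p (scl c x) = cmod c * p x"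
  using seminorm by (auto simp: seminorm_def)

lemma zero [simp]: "p 0 = 0"
  using scaled[of 0 0] by simp

lemma minus [simp]: "p (- x) = p x"
  using scaled[of "-1" x] by simp

lemma triangle_diff: "p (x - y) \<le> p x + p y"
  using triangle[of x "- y"] by simp

lemma diff_commute: "p (x - y) = p (y - x)"
  using minus[of "x - y"] by simp

lemma sum_bound: "(\<And>i. i \<in> I \<Longrightarrow> p (f i) \<le> g i) \<Longrightarrow> p (sum f I) \<le> sum g I"
proof (induction I rule: infinite_finite_induct)
  case (insert i I)
  have "p (f i + sum f I) \<le> p (f i) + p (sum f I)" by (rule triangle)
  also have "\<dots> \<le> g i + sum g I"
    using insert by (intro add_mono) auto
  finally show ?case using insert by simp
qed auto

end

lemma linear_funpow:
  assumes "Vector_Spaces.linear scl scl T"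
  shows "Vector_Spaces.linear scl scl (T ^^ n)"
proof (induction n)
  case 0
  interpret Vector_Spaces.linear scl scl T by fact
  show ?case using vs1.linear_id by (simp add: id_def)
next
  case (Suc n)
  show ?case using Vector_Spaces.linear_compose[OF Suc assms] by (simp add: o_def)
qed

section \<open>Shrinking the radius of a bounded resolvent\<close>

lemma sum_powers_roots_of_unity:
  fixes N j :: nat
  assumes "0 < j" "j < N"
  shows "(\<Sum>k<N. (cis (2 * pi / N) ^ k) ^ j) = 0"
proof -
  define z where "z = cis (2 * pi / N) ^ j"
  have z: "z = exp (2 * of_real pi * \<i> * of_nat j / of_nat N)"
    unfolding z_def by (simp add: cis_conv_exp exp_of_nat_mult[symmetric] field_simps)
  have "z \<noteq> 1"
    unfolding z using complex_root_unity_eq_1[of N j] assms by (auto dest: dvd_imp_le)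
  moreover have "z ^ N = 1"
    unfolding z using complex_root_unity[of N j] assms by simp
  moreover have "(cis (2 * pi / N) ^ k) ^ j = z ^ k" for k
    by (simp add: z_def power_mult[symmetric] mult.commute)
  ultimately show ?thesis by (simp add: geometric_sum)
qed

text \<open>A single seminorm is fixed here, together with its own constants \<open>c\<close> and \<open>M\<close>. Of the constants, only the
  radius \<open>t\<close> is shared by all seminorms of a calibration, so conclusions about rates of growth have to be
  stated in terms of \<open>t\<close>.\<close>

locale bounded_resolvent = seminormed_space scl p
  for scl :: "complex \<Rightarrow> 'a::ab_group_add \<Rightarrow> 'a" and p +
  fixes T :: "'a \<Rightarrow> 'a" and R :: "complex \<Rightarrow> 'a \<Rightarrow> 'a" and c t M :: real
  assumes linear_T: "Vector_Spaces.linear scl scl T"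
    and T_bound: "p (T x) \<le> c * p x"
    and linear_R: "cmod l > t \<Longrightarrow> Vector_Spaces.linear scl scl (R l)"
    and R_left: "cmod l > t \<Longrightarrow> R l (scl l x - T x) = x"
    and R_right: "cmod l > t \<Longrightarrow> scl l (R l x) - T (R l x) = x"
    and R_bound: "cmod l > t \<Longrightarrow> p (R l x) \<le> M * p x"
    and t_pos: "t > 0" and c_pos: "c > 0" and M_pos: "M > 0"
begin

interpretation T: Vector_Spaces.linear scl scl T by (rule linear_T)
interpretation Tn: Vector_Spaces.linear scl scl "T ^^ n" for n
  by (rule linear_funpow[OF linear_T])

lemma R_T_commute:
  assumes "cmod l > t"
  shows "R l (T x) = T (R l x)"
proof -
  interpret R: Vector_Spaces.linear scl scl "R l" using assms by (rule linear_R)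
  have "scl l (R l x) - R l (T x) = x"
    using R_left[OF assms, of x] by (simp add: R.diff R.scale)
  with R_right[OF assms, of x] have "scl l (R l x) - R l (T x) = scl l (R l x) - T (R l x)"
    by simp
  then show ?thesis by simp
qed

lemma R_funpow_commute:
  assumes "cmod l > t"
  shows "R l ((T ^^ n) x) = (T ^^ n) (R l x)"
  by (induction n) (auto simp: R_T_commute[OF assms])

text \<open>The resolvent equation, rewritten for \<open>l R(l) = (I - T/l)\<inverse>\<close>, which is the function that
  tends to the identity at infinity.\<close>

lemma scaled_resolvent_identity:
  assumes "cmod l > t" "cmod m > t"
  shows "scl l (R l x) - scl m (R m x) = scl (l - m) (R l (x - scl m (R m x)))"
proof -
  interpret Rl: Vector_Spaces.linear scl scl "R l" using assms(1) by (rule linear_R)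
  have Tm: "T (R m x) = scl m (R m x) - x"
    using R_right[OF assms(2), of x] by (simp add: algebra_simps)
  have "R m x = R l (scl l (R m x) - T (R m x))"
    by (rule R_left[OF assms(1), symmetric])
  also have "\<dots> = scl l (R l (R m x)) - scl m (R l (R m x)) + R l x"
    by (simp add: Tm Rl.diff Rl.scale)
  finally have "scl m (R m x) = scl m (scl l (R l (R m x)) - scl m (R l (R m x)) + R l x)"
    by simp
  then show ?thesis
    by (simp add: Rl.diff Rl.scale algebra_simps scale_left_diff_distrib scale_right_diff_distrib)
qed

lemma scaled_resolvent_Lipschitz:
  assumes "cmod l > t" "cmod m > t"
  shows "p (scl l (R l x) - scl m (R m x)) \<le> cmod (l - m) * M * (1 + cmod m * M) * p x"
proof -
  have "p (x - scl m (R m x)) \<le> p x + cmod m * p (R m x)"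
    using triangle_diff[of x "scl m (R m x)"] by simp
  also have "\<dots> \<le> p x + cmod m * (M * p x)"
    by (intro add_left_mono mult_left_mono R_bound assms) auto
  finally have *: "p (x - scl m (R m x)) \<le> (1 + cmod m * M) * p x"
    by (simp add: algebra_simps)
  have "p (scl l (R l x) - scl m (R m x)) = cmod (l - m) * p (R l (x - scl m (R m x)))"
    by (simp add: scaled_resolvent_identity[OF assms])
  also have "\<dots> \<le> cmod (l - m) * (M * ((1 + cmod m * M) * p x))"
    using M_pos by (intro mult_left_mono order_trans[OF R_bound[OF assms(1)]] *) auto
  finally show ?thesis by (simp add: mult.assoc)
qed

text \<open>The points of the circle of radius \<open>s\<close> run clockwise, which makes the powers of \<open>s / node\<close>
  positive powers of a root of unity.\<close>

definition node :: "nat \<Rightarrow> real \<Rightarrow> nat \<Rightarrow> complex" where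
  "node N s k = of_real s / cis (2 * pi / N) ^ k"

lemma cmod_node [simp]: "s > 0 \<Longrightarrow> cmod (node N s k) = s"
  by (simp add: node_def norm_divide norm_power)

lemma node_power: "N > 0 \<Longrightarrow> node N s k ^ N = of_real s ^ N"
proof -
  assume "N > 0"
  then have "cis (2 * pi / N) ^ N = 1" by (simp add: Complex.DeMoivre)
  then have "(cis (2 * pi / N) ^ k) ^ N = 1"
    by (metis power_mult mult.commute power_one)
  then show ?thesis by (simp add: node_def power_divide)
qed

definition circle_mean :: "nat \<Rightarrow> real \<Rightarrow> 'a \<Rightarrow> 'a" where
  "circle_mean N s x = scl (1 / of_nat N) (\<Sum>k<N. scl (node N s k) (R (node N s k) x))"

text \<open>Multiplying \<open>(I - T/l)\<inverse>\<close> by \<open>I - (T/l)\<^sup>N\<close> leaves a geometric sum.\<close>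

lemma scaled_resolvent_telescope:
  assumes "cmod l > t"
  shows "scl l (R l x) - scl (inverse l ^ N) ((T ^^ N) (scl l (R l x)))
           = (\<Sum>j<N. scl (inverse l ^ j) ((T ^^ j) x))"
proof (induction N)
  case (Suc N)
  define y where "y = scl l (R l x)"
  have "l \<noteq> 0" using assms t_pos by auto
  then have *: "y - scl (inverse l) (T y) = x"
    using R_right[OF assms, of x] by (simp add: y_def T.scale)
  have **: "scl (inverse l ^ N) ((T ^^ N) x)
      = scl (inverse l ^ N) ((T ^^ N) y) - scl (inverse l ^ Suc N) ((T ^^ Suc N) y)"
    by (subst *[symmetric])
       (simp add: Tn.diff Tn.scale scale_right_diff_distrib funpow_swap1 mult.commute)
  have "y - scl (inverse l ^ Suc N) ((T ^^ Suc N) y)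
      = (y - scl (inverse l ^ N) ((T ^^ N) y)) + scl (inverse l ^ N) ((T ^^ N) x)"
    unfolding ** by (simp only: diff_add_eq_diff_diff_swap diff_diff_eq2 add_diff_eq diff_add_cancel)
  then show ?case using Suc by (simp only: y_def sum.lessThan_Suc)
qed auto

text \<open>At each of the \<open>N\<close> nodes, \<open>l\<^sup>N = s\<^sup>N\<close>, so the factor \<open>I - (T/s)\<^sup>N\<close> is the same for all of
  them and turns each summand into a geometric sum in \<open>T/l\<close>. On averaging, orthogonality of the roots of unity
  leaves only the constant term.\<close>

lemma circle_mean_right_inverse:
  assumes "s > t" "N > 0"
  shows "circle_mean N s x - scl (inverse (of_real s) ^ N) ((T ^^ N) (circle_mean N s x)) = x"
proof -
  have s: "s > 0" using assms t_pos by simp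
  let ?l = "node N s"
  let ?y = "\<lambda>k. scl (?l k) (R (?l k) x)"
  let ?i = "inverse (of_real s) :: complex"
  have eq: "?y k - scl (?i ^ N) ((T ^^ N) (?y k)) = (\<Sum>j<N. scl (inverse (?l k) ^ j) ((T ^^ j) x))" for k
    using scaled_resolvent_telescope[of "?l k" x N] node_power[OF assms(2), of s k] s assms(1)
    by (simp add: power_inverse)
  have coef: "(\<Sum>k<N. inverse (?l k) ^ j) = (if j = 0 then of_nat N else 0)" if "j < N" for j
  proof -
    have "(\<Sum>k<N. inverse (?l k) ^ j) = (\<Sum>k<N. (cis (2 * pi / N) ^ k) ^ j) / of_real s ^ j"
      by (simp add: node_def sum_divide_distrib power_divide)
    then show ?thesis using sum_powers_roots_of_unity[of j N] that by auto
  qed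
  have "(\<Sum>k<N. ?y k) - scl (?i ^ N) ((T ^^ N) (\<Sum>k<N. ?y k))
      = (\<Sum>k<N. ?y k - scl (?i ^ N) ((T ^^ N) (?y k)))"
    by (simp add: Tn.sum scale_sum_right sum_subtractf)
  also have "\<dots> = (\<Sum>j<N. \<Sum>k<N. scl (inverse (?l k) ^ j) ((T ^^ j) x))"
    unfolding eq by (rule sum.swap)
  also have "\<dots> = (\<Sum>j<N. if j = 0 then scl (of_nat N) x else 0)"
    by (intro sum.cong) (auto simp: scale_sum_left[symmetric] coef)
  also have "\<dots> = scl (of_nat N) x"
    using assms(2) by (simp add: sum.delta)
  finally have "scl (1 / of_nat N) ((\<Sum>k<N. ?y k) - scl (?i ^ N) ((T ^^ N) (\<Sum>k<N. ?y k))) = x"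
    using assms(2) by simp
  then show ?thesis
    by (simp add: circle_mean_def Tn.scale scale_right_diff_distrib mult.commute)
qed

lemma circle_mean_commute:
  assumes "s > t"
  shows "circle_mean N s (scl a ((T ^^ N) x)) = scl a ((T ^^ N) (circle_mean N s x))"
proof -
  have s: "s > 0" using assms t_pos by simp
  have "R (node N s k) (scl a ((T ^^ N) x)) = scl a ((T ^^ N) (R (node N s k) x))" for k
  proof -
    have *: "cmod (node N s k) > t" using assms s by simp
    interpret R: Vector_Spaces.linear scl scl "R (node N s k)" using * by (rule linear_R)
    show ?thesis by (simp add: R.scale R_funpow_commute[OF *])
  qed
  then show ?thesis
    by (simp add: circle_mean_def Tn.scale Tn.sum scale_sum_right mult_ac)
qed

text \<open>The decisive point is that the bound is independent of \<open>N\<close>: both means are compared node by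
  node, along common rays.\<close>

lemma circle_mean_diff:
  assumes "s > t" "r > t" "N > 0"
  shows "p (circle_mean N r x - circle_mean N s x) \<le> \<bar>r - s\<bar> * M * (1 + s * M) * p x"
proof -
  have pos: "s > 0" "r > 0" using assms t_pos by auto
  let ?B = "\<bar>r - s\<bar> * M * (1 + s * M) * p x"
  let ?d = "\<lambda>k. scl (node N r k) (R (node N r k) x) - scl (node N s k) (R (node N s k) x)"
  have "cmod (node N r k - node N s k) = \<bar>r - s\<bar>" for k
    by (simp add: node_def diff_divide_distrib[symmetric] norm_divide norm_power
        of_real_diff[symmetric] del: of_real_diff)
  then have "p (?d k) \<le> ?B" for k
    using scaled_resolvent_Lipschitz[of "node N r k" "node N s k" x] assms pos by simp
  then have "p (\<Sum>k<N. ?d k) \<le> (\<Sum>k<N. ?B)"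
    by (intro sum_bound)
  then have "p (\<Sum>k<N. ?d k) \<le> N * ?B" by simp
  moreover have "circle_mean N r x - circle_mean N s x = scl (1 / of_nat N) (\<Sum>k<N. ?d k)"
    by (simp add: circle_mean_def scale_right_diff_distrib sum_subtractf)
  ultimately show ?thesis
    using assms(3) by (simp add: norm_divide field_simps)
qed

text \<open>Up to a slight enlargement of \<open>s\<close>, this says that \<open>(T/s)\<^sup>N\<close> tends to zero; it is the form of
  \<open>s\<close> being at least the spectral radius that is easiest to pass on from one radius to another.\<close>

definition dominated :: "real \<Rightarrow> bool" where
  "dominated s \<longleftrightarrow> (\<exists>N0. \<forall>N\<ge>N0. \<forall>x. p ((T ^^ N) x) \<le> s ^ N * p x)"

text \<open>With \<open>W v = (T/v)\<^sup>N\<close> and \<open>A v\<close> the mean over the circle of radius \<open>v\<close>: on the auxiliary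
  circle \<open>u > s\<close> the operator \<open>W u\<close> falls below \<open>1/8\<close> for large \<open>N\<close>, so \<open>A u = (I - W u)\<inverse>\<close> is within \<open>1/7\<close> of
  the identity. The means differ by at most \<open>1/8\<close>, hence \<open>A r\<close> is within \<open>1/2\<close> of the identity,
  and \<open>A r (W r) = A r - I\<close> then forces \<open>W r\<close> to be bounded by \<open>1\<close>.\<close>

lemma dominated_shrink:
  assumes dom: "dominated s" and "t < r" "r < s" "s < u"
    and close: "(u - r) * M * (1 + u * M) \<le> 1/8"
  shows "dominated r"
proof -
  have pos: "r > 0" "s > 0" "u > 0" using assms t_pos by auto
  obtain N0 where N0: "\<And>N x. N \<ge> N0 \<Longrightarrow> p ((T ^^ N) x) \<le> s ^ N * p x"
    using dom by (auto simp: dominated_def)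
  have "(\<lambda>N. (s / u) ^ N) \<longlonglongrightarrow> 0"
    using pos assms by (intro LIMSEQ_power_zero) auto
  then have "eventually (\<lambda>N. (s / u) ^ N < 1/8) sequentially"
    by (rule order_tendstoD) auto
  then obtain N1 where N1: "\<And>N. N \<ge> N1 \<Longrightarrow> (s / u) ^ N < 1/8"
    by (auto simp: eventually_sequentially)
  have "p ((T ^^ N) x) \<le> r ^ N * p x" if N: "N \<ge> max (max N0 N1) 1" for N x
  proof -
    let ?W = "\<lambda>v x. scl (inverse (of_real v) ^ N) ((T ^^ N) x)"
    have Npos: "N > 0" using N by simp
    have W: "p (?W u y) \<le> 1/8 * p y" for y
    proof -
      have "p (?W u y) = p ((T ^^ N) y) / u ^ N"
        using pos by (simp add: norm_power norm_inverse divide_inverse power_inverse mult.commute)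
      also have "\<dots> \<le> s ^ N * p y / u ^ N"
        using N N0[of N y] pos by (intro divide_right_mono) auto
      also have "\<dots> = (s / u) ^ N * p y" by (simp add: power_divide)
      also have "\<dots> \<le> 1/8 * p y"
        using N1[of N] N by (intro mult_right_mono) auto
      finally show ?thesis .
    qed
    have mean: "p (circle_mean N r y - y) \<le> 1/2 * p y" for y
    proof -
      let ?A = "circle_mean N u y"
      have "?A - y = ?W u ?A"
        using circle_mean_right_inverse[of u N y] assms Npos by (simp add: algebra_simps)
      then have "p (?A - y) \<le> 1/8 * p ?A" using W[of ?A] by simp
      moreover have "p ?A \<le> p (?A - y) + p y" using triangle[of "?A - y" y] by simp
      ultimately have 1: "p (?A - y) \<le> 1/7 * p y" by simp
      have "p (circle_mean N r y - ?A) \<le> \<bar>r - u\<bar> * M * (1 + u * M) * p y"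
        using assms Npos by (intro circle_mean_diff) auto
      also have "\<dots> \<le> 1/8 * p y"
        using close assms by (intro mult_right_mono) auto
      finally have "p (circle_mean N r y - y) \<le> 1/8 * p y + 1/7 * p y"
        using 1 triangle[of "circle_mean N r y - ?A" "?A - y"] by simp
      then show ?thesis using nonneg[of y] by linarith
    qed
    let ?w = "?W r x"
    have "circle_mean N r ?w = ?W r (circle_mean N r x)"
      using assms by (intro circle_mean_commute)
    also have "\<dots> = circle_mean N r x - x"
      using circle_mean_right_inverse[of r N x] assms Npos by (simp add: algebra_simps)
    finally have eq: "circle_mean N r ?w = circle_mean N r x - x" .
    have "p ?w \<le> p (circle_mean N r ?w) + p (circle_mean N r ?w - ?w)"
      using triangle_diff[of "circle_mean N r ?w" "circle_mean N r ?w - ?w"] by simp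
    also have "\<dots> \<le> 1/2 * p x + 1/2 * p ?w"
      by (intro add_mono mean) (simp only: eq mean)
    finally have "p ?w \<le> p x" by simp
    moreover have "p ?w = p ((T ^^ N) x) / r ^ N"
      using pos by (simp add: norm_power norm_inverse divide_inverse power_inverse mult.commute)
    ultimately have "p ((T ^^ N) x) / r ^ N \<le> p x" by (simp only:)
    then show ?thesis using pos by (simp only: pos_divide_le_eq zero_less_power mult.commute)
  qed
  then show ?thesis unfolding dominated_def by blast
qed

lemma funpow_bound: "p ((T ^^ n) x) \<le> c ^ n * p x"
proof (induction n)
  case (Suc n)
  have "p (T ((T ^^ n) x)) \<le> c * p ((T ^^ n) x)" by (rule T_bound)
  also have "\<dots> \<le> c * (c ^ n * p x)" using Suc c_pos by simp
  finally show ?case by simp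
qed simp

text \<open>The radius can be lowered by the constant step \<open>d\<close> as long as it stays above \<open>t\<close>, because
  the Lipschitz constant of \<open>l R(l)\<close> is bounded on the whole annulus that is crossed. The start
  \<open>u > c\<close> is beyond the bound of \<open>T\<close>.\<close>

lemma dominated_beyond_t:
  assumes "s > t"
  shows "dominated s"
proof -
  define u where "u = max s c + 1"
  (* Each step uses the circles of radii v + d and r with v - r at most d: they are at most 2 d
     apart and stay within radius u + 1. *)
  define d where "d = min 1 (1 / (16 * M * (1 + (u + 1) * M)))"
  have u: "u > 0" "s < u" "c < u" using assms t_pos by (auto simp: u_def)
  then have pos: "16 * M * (1 + (u + 1) * M) > 0"
    using M_pos by (intro mult_pos_pos add_pos_pos) auto
  then have d: "d > 0" "d \<le> 1" by (simp_all add: d_def)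
  have "d * (16 * M * (1 + (u + 1) * M)) \<le> 1"
    using pos by (simp only: pos_le_divide_eq[symmetric] d_def min.cobounded2)
  then have d16: "2 * d * M * (1 + (u + 1) * M) \<le> 1/8" by (simp add: algebra_simps)
  have window: "(v + d - r) * M * (1 + (v + d) * M) \<le> 2 * d * M * (1 + (u + 1) * M)"
    if "v \<le> u" "v > 0" "r \<le> v" "v - r \<le> d" for v r
    using that u(1) d M_pos by (intro mult_mono add_mono) auto
  have "dominated (max s (u - real n * d))" for n
  proof (induction n)
    case 0
    have "p ((T ^^ N) x) \<le> u ^ N * p x" for N x
      using funpow_bound[of N x] power_mono[of c u N] u c_pos
      by (meson less_imp_le mult_right_mono nonneg order_trans)
    then show ?case using u unfolding dominated_def by (simp add: max_def)
  next
    case (Suc n)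
    let ?v = "max s (u - real n * d)" and ?r = "max s (u - real (Suc n) * d)"
    have "real n * d \<ge> 0" using d by simp
    then have v: "?v \<le> u" "?v > 0" using u assms t_pos by auto
    have r: "?r \<le> ?v" "?v - ?r \<le> d" "t < ?r"
      using d assms by (auto simp: algebra_simps max_def)
    show ?case
    proof (cases "?r = ?v")
      case False
      have "(?v + d - ?r) * M * (1 + (?v + d) * M) \<le> 2 * d * M * (1 + (u + 1) * M)"
        by (rule window[OF v r(1,2)])
      also note d16
      finally show ?thesis
        using False r d by (intro dominated_shrink[OF Suc]) auto
    qed (use Suc in simp)
  qed
  moreover obtain n where "u < real n * d"
    using reals_Archimedean3[OF d(1)] by blast
  then have "max s (u - real n * d) = s" using assms t_pos by simp
  ultimately show ?thesis by metis
qed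

lemma power_bound_beyond_t:
  assumes "s > t"
  shows "\<exists>K. \<forall>n x. p ((T ^^ n) x) \<le> K * s ^ n * p x"
proof -
  have s: "s > 0" using assms t_pos by simp
  obtain N0 where N0: "\<And>N x. N \<ge> N0 \<Longrightarrow> p ((T ^^ N) x) \<le> s ^ N * p x"
    using dominated_beyond_t[OF assms] by (auto simp: dominated_def)
  (* The sum takes care of the finitely many exponents below N0. *)
  define K where "K = 1 + (\<Sum>n<N0. (c / s) ^ n)"
  have K: "K \<ge> 1" using s c_pos by (auto simp: K_def intro!: sum_nonneg)
  have "p ((T ^^ n) x) \<le> K * s ^ n * p x" for n x
  proof (cases "n \<ge> N0")
    case True
    have "1 * s ^ n * p x \<le> K * s ^ n * p x"
      using K s by (intro mult_right_mono) auto
    with N0[OF True, of x] show ?thesis by simp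
  next
    case False
    then have "(c / s) ^ n \<le> (\<Sum>n<N0. (c / s) ^ n)"
      using s c_pos by (intro member_le_sum) auto
    then have "(c / s) ^ n * s ^ n \<le> K * s ^ n" using s by (intro mult_right_mono) (auto simp: K_def)
    then have "c ^ n \<le> K * s ^ n" using s by (simp add: power_divide)
    then have "c ^ n * p x \<le> K * s ^ n * p x" by (intro mult_right_mono) auto
    with funpow_bound[of n x] show ?thesis by simp
  qed
  then show ?thesis by blast
qed

end

section \<open>Topologies generated by seminorms\<close>

text \<open>Seminorms on a subspace: the operator seminorms are homogeneous and subadditive on the quotient
  bounded operators, while elsewhere the infimum that defines them may be taken over the empty set.\<close>

definition seminorm_on :: "(complex \<Rightarrow> 'v::ab_group_add \<Rightarrow> 'v) \<Rightarrow> 'v set \<Rightarrow> ('v \<Rightarrow> real) \<Rightarrow> bool" where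
  "seminorm_on scl V q \<longleftrightarrow>
     (\<forall>x\<in>V. q x \<ge> 0) \<and> (\<forall>x\<in>V. \<forall>y\<in>V. q (x + y) \<le> q x + q y) \<and>
     (\<forall>c. \<forall>x\<in>V. q (scl c x) = cmod c * q x)"

lemma seminorm_on_UNIV: "seminorm_on scl UNIV = seminorm scl"
  by (auto simp: seminorm_on_def seminorm_def fun_eq_iff)

lemma openin_seminorm_ball:
  "q \<in> Q \<Longrightarrow> x \<in> V \<Longrightarrow> e > 0 \<Longrightarrow> openin (seminorm_topology V Q) {y \<in> V. q (y - x) < e}"
  unfolding seminorm_topology_def by (rule topology_generated_by_Basis) auto

text \<open>Finite intersections of centred semi-balls form a neighbourhood base of zero, although the
  subbase has balls with arbitrary centres: a ball about \<open>x\<close> of radius \<open>e\<close> that contains \<open>0\<close>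
  contains the ball about \<open>0\<close> of radius \<open>e - q (- x)\<close>.\<close>

lemma seminorm_topology_nhd_zero:
  assumes vs: "vector_space scl" and V: "module.subspace scl V"
    and Q: "\<And>q. q \<in> Q \<Longrightarrow> seminorm_on scl V q"
    and U: "openin (seminorm_topology V Q) U" "0 \<in> U"
  shows "\<exists>F e. finite F \<and> F \<subseteq> Q \<and> e > 0 \<and> {y \<in> V. \<forall>q\<in>F. q y < e} \<subseteq> U"
proof -
  interpret vector_space scl by fact
  have "generate_topology_on
          (insert V {{y \<in> V. q (y - x) < e} | q x e. q \<in> Q \<and> x \<in> V \<and> e > 0}) U"
    using U(1) by (simp add: seminorm_topology_def openin_topology_generated_by_iff)
  from this U(2) show ?thesis
  proof induction
    case (Int A B)
    then obtain F e G d where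
      "finite F" "F \<subseteq> Q" "e > 0" "{y \<in> V. \<forall>q\<in>F. q y < e} \<subseteq> A"
      "finite G" "G \<subseteq> Q" "d > 0" "{y \<in> V. \<forall>q\<in>G. q y < d} \<subseteq> B"
      by (elim IntE) blast
    then show ?case
      by (intro exI[of _ "F \<union> G"] exI[of _ "min e d"]) auto
  next
    case (UN K)
    then obtain A where "A \<in> K" "0 \<in> A" by blast
    then show ?case using UN.IH[of A] by (meson Union_upper order_trans)
  next
    case (Basis S)
    then consider "S = V"
      | q x e where "S = {y \<in> V. q (y - x) < e}" "q \<in> Q" "x \<in> V" "e > 0" by blast
    then show ?case
    proof cases
      case 1
      then show ?thesis by (intro exI[of _ "{}"] exI[of _ 1]) auto
    next
      case (2 q x e)
      have minus: "- x \<in> V" using V 2(3) by (rule subspace_neg)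
      have "q (y - x) < e" if "y \<in> V" "q y < e - q (- x)" for y
        using Q[OF 2(2)] that minus unfolding seminorm_on_def
        by (metis add.commute diff_conv_add_uminus less_diff_eq order_le_less_trans)
      moreover have "e - q (- x) > 0" using Basis(2) 2(1) by simp
      ultimately show ?thesis
        using 2 by (intro exI[of _ "{q}"] exI[of _ "e - q (- x)"]) auto
    qed
  qed auto
qed

lemma tvs_bounded_seminorm_topology:
  assumes vs: "vector_space scl" and V: "module.subspace scl V"
    and Q: "\<And>q. q \<in> Q \<Longrightarrow> seminorm_on scl V q"
  shows "tvs_bounded scl (seminorm_topology V Q) B \<longleftrightarrow>
           B \<subseteq> V \<and> (\<forall>q\<in>Q. \<exists>M. \<forall>b\<in>B. q b \<le> M)"
proof -
  interpret vector_space scl by fact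
  have q0: "q 0 = 0" if "q \<in> Q" for q
    using Q[OF that] subspace_0[OF V] unfolding seminorm_on_def
    by (metis mult_zero_left norm_zero scale_zero_left)
  show ?thesis
  proof (intro iffI conjI ballI)
    assume B: "tvs_bounded scl (seminorm_topology V Q) B"
    then show "B \<subseteq> V" by (simp add: tvs_bounded_def)
    fix q assume q: "q \<in> Q"
    let ?U = "{y \<in> V. q (y - 0) < 1}"
    have "openin (seminorm_topology V Q) ?U" "0 \<in> ?U"
      using subspace_0[OF V] q0[OF q] q by (auto intro: openin_seminorm_ball[of q Q 0 V 1, simplified])
    then obtain r where r: "r > 0" "\<forall>c. cmod c \<ge> r \<longrightarrow> B \<subseteq> scl c ` ?U"
      using B unfolding tvs_bounded_def by metis
    have "q b \<le> r" if "b \<in> B" for b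
    proof -
      have "B \<subseteq> scl (of_real r) ` ?U" using r by simp
      then have "b \<in> scl (of_real r) ` ?U" using that by blast
      then obtain y where "b = scl (of_real r) y" "y \<in> V" "q y < 1" by auto
      then show ?thesis using Q[OF q] r(1) by (simp add: seminorm_on_def)
    qed
    then show "\<exists>M. \<forall>b\<in>B. q b \<le> M" by blast
  next
    assume "B \<subseteq> V \<and> (\<forall>q\<in>Q. \<exists>M. \<forall>b\<in>B. q b \<le> M)"
    then obtain m where BV: "B \<subseteq> V" and m: "\<And>q b. q \<in> Q \<Longrightarrow> b \<in> B \<Longrightarrow> q b \<le> m q"
      by metis
    show "tvs_bounded scl (seminorm_topology V Q) B"
      unfolding tvs_bounded_def
    proof (intro conjI allI impI, goal_cases)
      case 1
      show ?case using BV by simp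
    next
      case (2 U)
      then obtain F e where F: "finite F" "F \<subseteq> Q" "e > 0" "{y \<in> V. \<forall>q\<in>F. q y < e} \<subseteq> U"
        using seminorm_topology_nhd_zero[OF vs V Q, of Q U] by blast
      define r where "r = (1 + (\<Sum>q\<in>F. \<bar>m q\<bar>)) / e"
      have "1 + (\<Sum>q\<in>F. \<bar>m q\<bar>) > 0" by (intro add_pos_nonneg sum_nonneg) auto
      then have r: "r > 0" using F by (simp add: r_def)
      have "b \<in> scl c ` U" if c: "r \<le> cmod c" and b: "b \<in> B" for c b
      proof -
        have c0: "c \<noteq> 0" using c r by auto
        have "q (scl (1 / c) b) < e" if q: "q \<in> F" for q
        proof -
          have "\<bar>m q\<bar> \<le> (\<Sum>q\<in>F. \<bar>m q\<bar>)" using q F by (intro member_le_sum) auto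
          then have "q b < r * e" using m[of q b] q F b by (auto simp: r_def)
          also have "\<dots> \<le> cmod c * e" using c F by (intro mult_right_mono) auto
          finally have "q b / cmod c < e" using c0 by (simp add: pos_divide_less_eq mult.commute)
          moreover have "q (scl (1 / c) b) = cmod (1 / c) * q b"
            using Q[of q] q F b BV unfolding seminorm_on_def by blast
          ultimately show ?thesis by (simp add: norm_divide)
        qed
        then have "scl (1 / c) b \<in> U"
          using F b BV subspace_scale[OF V] by blast
        moreover have "b = scl c (scl (1 / c) b)" using c0 by simp
        ultimately show ?thesis by blast
      qed
      with r show ?case by blast
    qed
  qed
qed

section \<open>The algebra of quotient bounded operators\<close>

lemma vector_space_op_scale:
  assumes "vector_space scl"
  shows "vector_space (op_scale scl)"
proof -
  interpret vector_space scl by fact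
  show ?thesis
    by unfold_locales
       (auto simp: op_scale_def fun_eq_iff scale_right_distrib scale_left_distrib)
qed

lemma quotient_bounded_linear: "S \<in> quotient_bounded scl P \<Longrightarrow> Vector_Spaces.linear scl scl S"
  by (simp add: quotient_bounded_def)

lemma subspace_quotient_bounded:
  assumes vs: "vector_space scl" and P: "\<And>p. p \<in> P \<Longrightarrow> seminorm scl p"
  shows "module.subspace (op_scale scl) (quotient_bounded scl P)"
proof -
  interpret vector_space scl by fact
  interpret vector_space_pair scl scl by unfold_locales
  interpret ops: vector_space "op_scale scl" using vs by (rule vector_space_op_scale)
  show ?thesis
  proof (rule ops.subspaceI)
    have "\<exists>c>0. \<forall>x. p (0 x) \<le> c * p x" if "p \<in> P" for p
    proof -
      interpret seminormed_space scl p by unfold_locales (rule P[OF that])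
      show ?thesis by (intro exI[of _ 1]) auto
    qed
    then show "0 \<in> quotient_bounded scl P"
      by (simp add: quotient_bounded_def zero_fun_def linear_zero)
  next
    fix S S' assume S: "S \<in> quotient_bounded scl P" "S' \<in> quotient_bounded scl P"
    have "\<exists>c>0. \<forall>x. p ((S + S') x) \<le> c * p x" if p: "p \<in> P" for p
    proof -
      interpret seminormed_space scl p by unfold_locales (rule P[OF p])
      obtain a b where ab: "a > 0" "b > 0" "\<And>x. p (S x) \<le> a * p x" "\<And>x. p (S' x) \<le> b * p x"
        using S p unfolding quotient_bounded_def by blast
      have "p (S x + S' x) \<le> (a + b) * p x" for x
        using triangle[of "S x" "S' x"] ab(3,4)[of x] by (simp add: algebra_simps)
      then show ?thesis using ab by (intro exI[of _ "a + b"]) auto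
    qed
    then show "S + S' \<in> quotient_bounded scl P"
      using S linear_compose_add by (auto simp: quotient_bounded_def plus_fun_def)
  next
    fix c S assume S: "S \<in> quotient_bounded scl P"
    have "\<exists>d>0. \<forall>x. p (op_scale scl c S x) \<le> d * p x" if p: "p \<in> P" for p
    proof -
      interpret seminormed_space scl p by unfold_locales (rule P[OF p])
      obtain a where a: "a > 0" "\<And>x. p (S x) \<le> a * p x"
        using S p unfolding quotient_bounded_def by blast
      have "cmod c * p (S x) \<le> (cmod c * a + 1) * p x" for x
      proof -
        have "cmod c * p (S x) \<le> cmod c * (a * p x)" using a by (intro mult_left_mono) auto
        also have "\<dots> \<le> (cmod c * a + 1) * p x" by (simp add: algebra_simps)
        finally show ?thesis .
      qed
      then show ?thesis
        using a by (intro exI[of _ "cmod c * a + 1"]) (auto simp: op_scale_def intro: add_nonneg_pos)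
    qed
    then show "op_scale scl c S \<in> quotient_bounded scl P"
      using S linear_compose_scale_right[of S c]
      by (auto simp: quotient_bounded_def op_scale_def)
  qed
qed

text \<open>The infimum in the operator seminorm is attained as a bound, and may be \<open>0\<close> although only
  positive bounds compete.\<close>

lemma op_seminorm_le_iff:
  assumes "seminorm scl p" and S: "\<exists>c>0. \<forall>x. p (S x) \<le> c * p x" and "r \<ge> 0"
  shows "op_seminorm p S \<le> r \<longleftrightarrow> (\<forall>x. p (S x) \<le> r * p x)"
proof
  let ?A = "{r. r > 0 \<and> (\<forall>x. p (S x) \<le> r * p x)}"
  have bdd: "bdd_below ?A" by (rule bdd_belowI[of _ 0]) auto
  have nonneg: "p x \<ge> 0" for x using assms(1) by (simp add: seminorm_def)
  have bound_above: "p (S x) \<le> r' * p x" if "r < r'" "op_seminorm p S \<le> r" for r r' x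
  proof -
    have "?A \<noteq> {}" using S by auto
    then have "\<exists>a\<in>?A. a < r'"
      using that unfolding op_seminorm_def by (intro cInf_lessD) auto
    then obtain a where "a \<in> ?A" "a < r'" by blast
    then show ?thesis
      by (smt (verit) mem_Collect_eq mult_right_mono nonneg)
  qed
  show "\<forall>x. p (S x) \<le> r * p x" if *: "op_seminorm p S \<le> r"
  proof
    fix x
    have "((\<lambda>r'. r' * p x) \<longlongrightarrow> r * p x) (at_right r)" by (intro tendsto_intros)
    moreover have "eventually (\<lambda>r'. p (S x) \<le> r' * p x) (at_right r)"
      using eventually_at_right_less[of r] by eventually_elim (rule bound_above[OF _ *])
    ultimately show "p (S x) \<le> r * p x" by (rule tendsto_lowerbound) simp
  qed
  assume *: "\<forall>x. p (S x) \<le> r * p x"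
  show "op_seminorm p S \<le> r"
  proof (rule field_le_epsilon)
    fix e :: real assume "e > 0"
    then have "p (S x) \<le> (r + e) * p x" for x
      using *[rule_format, of x] nonneg[of x] by (simp add: algebra_simps add_increasing)
    then have "r + e \<in> ?A" using \<open>e > 0\<close> assms(3) by auto
    then show "op_seminorm p S \<le> r + e"
      unfolding op_seminorm_def using bdd by (rule cInf_lower)
  qed
qed

lemma op_seminorm_nonneg:
  assumes "\<exists>c>0. \<forall>x. p (S x) \<le> c * p x"
  shows "op_seminorm p S \<ge> 0"
  unfolding op_seminorm_def using assms by (intro cInf_greatest) auto

lemma op_seminorm_bound:
  assumes "seminorm scl p" and "\<exists>c>0. \<forall>x. p (S x) \<le> c * p x"
  shows "p (S x) \<le> op_seminorm p S * p x"
  using op_seminorm_le_iff[OF assms op_seminorm_nonneg[OF assms(2)]] by simp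

lemma seminorm_on_op_seminorm:
  assumes vs: "vector_space scl" and P: "\<And>p. p \<in> P \<Longrightarrow> seminorm scl p" and p: "p \<in> P"
  shows "seminorm_on (op_scale scl) (quotient_bounded scl P) (op_seminorm p)"
proof -
  interpret vector_space scl by fact
  interpret seminormed_space scl p by unfold_locales (rule P[OF p])
  interpret ops: vector_space "op_scale scl" using vs by (rule vector_space_op_scale)
  let ?V = "quotient_bounded scl P"
  have sub: "ops.subspace ?V" using vs P by (rule subspace_quotient_bounded)
  have bdd: "\<exists>c>0. \<forall>x. p (S x) \<le> c * p x" if "S \<in> ?V" for S
    using that p unfolding quotient_bounded_def by blast
  note bound = op_seminorm_bound[OF seminorm bdd]
  note nn = op_seminorm_nonneg[OF bdd]
  have scale_le: "op_seminorm p (op_scale scl c S) \<le> cmod c * op_seminorm p S" if S: "S \<in> ?V" for c S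
    using op_seminorm_le_iff[OF seminorm bdd[OF ops.subspace_scale[OF sub S]],
        of "cmod c * op_seminorm p S" c] nn[OF S] bound[OF S]
    by (simp add: op_scale_def mult.assoc mult_left_mono)
  show ?thesis
    unfolding seminorm_on_def
  proof (intro conjI ballI allI)
    fix S assume S: "S \<in> ?V"
    then show "op_seminorm p S \<ge> 0" by (rule nn)
    show "op_seminorm p (op_scale scl c S) = cmod c * op_seminorm p S" for c
    proof (cases "c = 0")
      case True
      then have "cmod c * op_seminorm p S = 0" by simp
      with scale_le[OF S, of c] nn[OF ops.subspace_scale[OF sub S], of c] show ?thesis by linarith
    next
      case False
      have "op_seminorm p S = op_seminorm p (op_scale scl (1 / c) (op_scale scl c S))"
        using False by simp
      also have "\<dots> \<le> cmod (1 / c) * op_seminorm p (op_scale scl c S)"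
        by (rule scale_le[OF ops.subspace_scale[OF sub S]])
      finally have "cmod c * op_seminorm p S \<le> op_seminorm p (op_scale scl c S)"
        using False by (simp add: norm_divide field_simps)
      with scale_le[OF S, of c] show ?thesis by simp
    qed
    fix S' assume S': "S' \<in> ?V"
    have "p ((S + S') x) \<le> (op_seminorm p S + op_seminorm p S') * p x" for x
      using triangle[of "S x" "S' x"] bound[OF S, of x] bound[OF S', of x]
      by (simp add: algebra_simps)
    then show "op_seminorm p (S + S') \<le> op_seminorm p S + op_seminorm p S'"
      using op_seminorm_le_iff[OF seminorm bdd[OF ops.subspace_add[OF sub S S']]]
        add_nonneg_nonneg[OF nn[OF S] nn[OF S']] by blast
  qed
qed

text \<open>Reduces the topological notion to uniform estimates on vectors, the form in which both
  directions of the equivalence are carried out.\<close>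

lemma qb_bounded_iff:
  assumes vs: "vector_space scl" and P: "\<And>p. p \<in> P \<Longrightarrow> seminorm scl p"
  shows "qb_bounded scl P B \<longleftrightarrow>
     B \<subseteq> quotient_bounded scl P \<and> (\<forall>p\<in>P. \<exists>M>0. \<forall>S\<in>B. \<forall>x. p (S x) \<le> M * p x)"
proof -
  let ?V = "quotient_bounded scl P"
  have "(\<exists>M. \<forall>S\<in>B. op_seminorm p S \<le> M) \<longleftrightarrow> (\<exists>M>0. \<forall>S\<in>B. \<forall>x. p (S x) \<le> M * p x)"
    if B: "B \<subseteq> ?V" and p: "p \<in> P" for p
  proof -
    have *: "op_seminorm p S \<le> M \<longleftrightarrow> (\<forall>x. p (S x) \<le> M * p x)" if "S \<in> B" "M > 0" for S M
      using that B p by (intro op_seminorm_le_iff[OF P[OF p]]) (auto simp: quotient_bounded_def)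
    show ?thesis
    proof
      assume "\<exists>M. \<forall>S\<in>B. op_seminorm p S \<le> M"
      then obtain M where "\<forall>S\<in>B. op_seminorm p S \<le> M" by blast
      then have "\<forall>S\<in>B. op_seminorm p S \<le> max M 1" by fastforce
      then show "\<exists>M>0. \<forall>S\<in>B. \<forall>x. p (S x) \<le> M * p x"
        using * by (intro exI[of _ "max M 1"]) auto
    next
      assume "\<exists>M>0. \<forall>S\<in>B. \<forall>x. p (S x) \<le> M * p x"
      then show "\<exists>M. \<forall>S\<in>B. op_seminorm p S \<le> M" using * by blast
    qed
  qed
  moreover have "seminorm_on (op_scale scl) ?V q" if "q \<in> op_seminorm ` P" for q
    using that seminorm_on_op_seminorm[OF vs P] by auto
  ultimately show ?thesis
    unfolding qb_bounded_def qb_topology_def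
    using tvs_bounded_seminorm_topology[OF vector_space_op_scale[OF vs]
        subspace_quotient_bounded[OF vs P], where Q = "op_seminorm ` P" and B = B]
    by auto
qed

lemma qb_boundedD:
  assumes "vector_space scl" and "\<And>p. p \<in> P \<Longrightarrow> seminorm scl p"
    and "qb_bounded scl P B" and "p \<in> P"
  shows "\<exists>M>0. \<forall>S\<in>B. \<forall>x. p (S x) \<le> M * p x"
  using iffD1[OF qb_bounded_iff[OF assms(1,2)] assms(3)] assms(4) by blast

lemma qb_boundedI:
  assumes "vector_space scl" and "\<And>p. p \<in> P \<Longrightarrow> seminorm scl p"
    and "B \<subseteq> quotient_bounded scl P"
    and "\<And>p. p \<in> P \<Longrightarrow> \<exists>M>0. \<forall>S\<in>B. \<forall>x. p (S x) \<le> M * p x"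
  shows "qb_bounded scl P B"
  using iffD2[OF qb_bounded_iff[OF assms(1,2)]] assms(3,4) by blast

section \<open>Neumann series\<close>

lemma (in seminormed_space) sum_increment:
  fixes a :: "nat \<Rightarrow> 'a"
  assumes "\<And>k. p (a k) \<le> g k"
  shows "p ((\<Sum>k<m. a k) - (\<Sum>k<n. a k)) \<le> \<bar>(\<Sum>k<m. g k) - (\<Sum>k<n. g k)\<bar>"
proof -
  have *: "p ((\<Sum>k<m. a k) - (\<Sum>k<n. a k)) \<le> (\<Sum>k<m. g k) - (\<Sum>k<n. g k)" if "n \<le> m" for m n :: nat
    using sum_diff_nat_ivl[of 0 n m a] sum_diff_nat_ivl[of 0 n m g] that
      sum_bound[of "{n..<m}" a g] assms
    by (simp add: atLeast0LessThan)
  show ?thesis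
    using *[of n m] *[of m n] by (cases "n \<le> m") (auto simp: diff_commute)
qed

lemma (in seminormed_space) bound_of_series:
  assumes a: "\<And>k. p (a k) \<le> g k" and "summable g"
    and lim: "(\<lambda>n. p (y - (\<Sum>k<n. a k))) \<longlonglongrightarrow> 0"
  shows "p y \<le> suminf g"
proof -
  have g0: "g k \<ge> 0" for k using a[of k] nonneg[of "a k"] by linarith
  have "p y \<le> p (y - (\<Sum>k<n. a k)) + suminf g" for n
  proof -
    have "p (\<Sum>k<n. a k) \<le> (\<Sum>k<n. g k)" by (rule sum_bound) (rule a)
    also have "\<dots> \<le> suminf g" using assms(2) g0 by (intro sum_le_suminf) auto
    finally show ?thesis
      using triangle[of "y - (\<Sum>k<n. a k)" "\<Sum>k<n. a k"] by simp
  qed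
  moreover have "(\<lambda>n. p (y - (\<Sum>k<n. a k)) + suminf g) \<longlonglongrightarrow> 0 + suminf g"
    by (intro tendsto_add lim tendsto_const)
  ultimately show ?thesis using LIMSEQ_le_const by fastforce
qed

text \<open>Sequential completeness yields one limit for all seminorms at once.\<close>

lemma absolutely_summable_convergent:
  assumes vs: "vector_space scl" and P: "\<And>p. p \<in> P \<Longrightarrow> seminorm scl p"
    and complete: "sequentially_complete (seminorm_topology UNIV P)"
    and g: "\<And>p. p \<in> P \<Longrightarrow> summable (g p)" "\<And>p k. p \<in> P \<Longrightarrow> p (a k) \<le> g p k"
  shows "\<exists>y. \<forall>p\<in>P. (\<lambda>n. p (y - (\<Sum>k<n. a k))) \<longlonglongrightarrow> 0"
proof -
  interpret vector_space scl by fact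
  let ?s = "\<lambda>n. \<Sum>k<n. a k"
  have Cauchy: "\<exists>N. \<forall>m\<ge>N. \<forall>n\<ge>N. p (?s m - ?s n) < e" if p: "p \<in> P" and "e > 0" for p e
  proof -
    interpret seminormed_space scl p by unfold_locales (rule P[OF p])
    have "Cauchy (\<lambda>n. \<Sum>k<n. g p k)"
      using g(1)[OF p] by (simp add: summable_iff_convergent convergent_Cauchy)
    then obtain N where "\<And>m n. m \<ge> N \<Longrightarrow> n \<ge> N \<Longrightarrow> \<bar>(\<Sum>k<m. g p k) - (\<Sum>k<n. g p k)\<bar> < e"
      using \<open>e > 0\<close> unfolding Cauchy_def dist_real_def by blast
    then show ?thesis
      using sum_increment[of a "g p", OF g(2)[OF p]] by (meson order_le_less_trans)
  qed
  have "tvs_Cauchy (seminorm_topology UNIV P) ?s"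
    unfolding tvs_Cauchy_def
  proof (intro allI impI)
    fix U assume U: "openin (seminorm_topology UNIV P) U \<and> 0 \<in> U"
    have "\<exists>F e. finite F \<and> F \<subseteq> P \<and> e > 0 \<and> {y \<in> UNIV. \<forall>q\<in>F. q y < e} \<subseteq> U"
      using U P by (intro seminorm_topology_nhd_zero[OF vs]) (auto simp: seminorm_on_UNIV)
    then obtain F e where F: "finite F" "F \<subseteq> P" "e > 0" "{y \<in> UNIV. \<forall>q\<in>F. q y < e} \<subseteq> U"
      by blast
    have "\<forall>q\<in>F. eventually (\<lambda>N. \<forall>m\<ge>N. \<forall>n\<ge>N. q (?s m - ?s n) < e) sequentially"
      unfolding eventually_sequentially using Cauchy[OF _ F(3)] F(2) by (meson in_mono order_trans)
    with F(1) have "eventually (\<lambda>N. \<forall>q\<in>F. \<forall>m\<ge>N. \<forall>n\<ge>N. q (?s m - ?s n) < e) sequentially"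
      by (rule eventually_ball_finite)
    then obtain N where "\<forall>q\<in>F. \<forall>m\<ge>N. \<forall>n\<ge>N. q (?s m - ?s n) < e"
      by (auto simp: eventually_sequentially)
    with F(4) show "\<exists>N. \<forall>m\<ge>N. \<forall>n\<ge>N. ?s m - ?s n \<in> U" by blast
  qed
  with complete obtain y where y: "limitin (seminorm_topology UNIV P) ?s y sequentially"
    unfolding sequentially_complete_def by blast
  have "(\<lambda>n. p (y - ?s n)) \<longlonglongrightarrow> 0" if p: "p \<in> P" for p
  proof (rule tendstoI)
    interpret seminormed_space scl p by unfold_locales (rule P[OF p])
    fix e :: real assume "e > 0"
    then have "openin (seminorm_topology UNIV P) {z \<in> UNIV. p (z - y) < e}" "y \<in> {z \<in> UNIV. p (z - y) < e}"
      using p by (auto intro: openin_seminorm_ball[of p P y UNIV e, simplified])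
    with y have "eventually (\<lambda>n. ?s n \<in> {z \<in> UNIV. p (z - y) < e}) sequentially"
      unfolding limitin_def by blast
    then show "eventually (\<lambda>n. dist (p (y - ?s n)) 0 < e) sequentially"
      by eventually_elim (simp add: diff_commute)
  qed
  then show ?thesis by blast
qed

lemma Hausdorff_seminorms_separate:
  assumes vs: "vector_space scl" and P: "\<And>p. p \<in> P \<Longrightarrow> seminorm scl p"
    and "Hausdorff_space (seminorm_topology UNIV P)"
    and x: "\<And>p. p \<in> P \<Longrightarrow> p x = 0"
  shows "x = 0"
proof (rule ccontr)
  interpret vector_space scl by fact
  assume "x \<noteq> 0"
  then obtain U where U: "openin (seminorm_topology UNIV P) U" "0 \<in> U" "x \<notin> U"
    using assms(3) unfolding Hausdorff_space_def
    by (metis UNIV_I disjnt_iff topspace_seminorm_topology)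
  have "\<exists>F e. finite F \<and> F \<subseteq> P \<and> e > 0 \<and> {y \<in> UNIV. \<forall>q\<in>F. q y < e} \<subseteq> U"
    using U P by (intro seminorm_topology_nhd_zero[OF vs]) (auto simp: seminorm_on_UNIV)
  then obtain F e where "F \<subseteq> P" "e > 0" "{y \<in> UNIV. \<forall>q\<in>F. q y < e} \<subseteq> U" by blast
  moreover from this have "\<forall>q\<in>F. q x < e" using x by (metis in_mono)
  ultimately show False using U(3) by blast
qed

text \<open>The factor \<open>2\<close> in \<open>\<bar>l\<bar> \<ge> 2 r\<close> keeps the ratio of the dominating series at most \<open>1/2\<close>, so that its
  sum, and with it the bound on the resolvent, is uniform in \<open>l\<close>. It is enough to solve
  \<open>l y - T y = x\<close> by the series and to see that \<open>T y = l y\<close> forces \<open>y = 0\<close>: the solution operator is then the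
  two-sided inverse, and its linearity follows from uniqueness.\<close>

lemma Neumann_resolvent:
  assumes vs: "vector_space scl" and P: "\<And>p. p \<in> P \<Longrightarrow> seminorm scl p"
    and complete: "sequentially_complete (seminorm_topology UNIV P)"
    and Hausdorff: "Hausdorff_space (seminorm_topology UNIV P)"
    and T: "T \<in> quotient_bounded scl P"
    and K: "\<And>p n x. p \<in> P \<Longrightarrow> p ((T ^^ n) x) \<le> K p * r ^ n * p x"
    and K_pos: "\<And>p. p \<in> P \<Longrightarrow> K p > 0" and r: "r > 0" and l: "cmod l \<ge> 2 * r"
  shows "\<exists>R\<in>quotient_bounded scl P.
           R \<circ> (op_scale scl l id - T) = id \<and> (op_scale scl l id - T) \<circ> R = id \<and>
           (\<forall>p\<in>P. \<forall>x. p (R x) \<le> K p / r * p x)"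
proof -
  interpret T: Vector_Spaces.linear scl scl T using T by (rule quotient_bounded_linear)
  note separate = Hausdorff_seminorms_separate[OF vs P Hausdorff]
  let ?A = "\<lambda>x. scl l x - T x"
  have l0: "l \<noteq> 0" using r l by auto
  have ratio: "r ^ k / cmod l ^ k \<le> (1/2) ^ k" for k
  proof -
    have "(r / cmod l) ^ k \<le> (1/2) ^ k"
      using r l l0 by (intro power_mono) (auto simp: field_simps)
    then show ?thesis by (simp add: power_divide)
  qed
  have powers: "p (scl (1 / l ^ n) ((T ^^ n) x)) \<le> K p * (1/2) ^ n * p x" if p: "p \<in> P" for p n x
  proof -
    interpret seminormed_space scl p by unfold_locales (rule P[OF p])
    have "p (scl (1 / l ^ n) ((T ^^ n) x)) = p ((T ^^ n) x) / cmod l ^ n"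
      by (simp add: norm_divide norm_power)
    also have "\<dots> \<le> (K p * r ^ n * p x) / cmod l ^ n"
      using K[OF p] by (intro divide_right_mono) auto
    also have "\<dots> = K p * (r ^ n / cmod l ^ n) * p x" by simp
    also have "\<dots> \<le> K p * (1/2) ^ n * p x"
      using ratio K_pos[OF p] by (intro mult_right_mono mult_left_mono) auto
    finally show ?thesis .
  qed
  have "\<exists>y. ?A y = x \<and> (\<forall>p\<in>P. p y \<le> K p / r * p x)" for x
  proof -
    define a where "a k = scl (1 / l) (scl (1 / l ^ k) ((T ^^ k) x))" for k
    let ?s = "\<lambda>n. \<Sum>k<n. a k"
    define g where "g p k = K p * p x / cmod l * (1/2) ^ k" for p :: "'a \<Rightarrow> real" and k :: nat
    have a: "p (a k) \<le> g p k" if p: "p \<in> P" for p k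
    proof -
      interpret seminormed_space scl p by unfold_locales (rule P[OF p])
      have "p (a k) = p (scl (1 / l ^ k) ((T ^^ k) x)) / cmod l"
        unfolding a_def scaled by (simp add: norm_divide)
      also have "\<dots> \<le> (K p * (1/2) ^ k * p x) / cmod l"
        using powers[OF p] by (intro divide_right_mono) auto
      also have "\<dots> = g p k" by (simp add: g_def)
      finally show ?thesis .
    qed
    have g_sums: "g p sums (2 * (K p * p x / cmod l))" for p :: "'a \<Rightarrow> real"
      unfolding g_def using sums_mult[OF geometric_sums[of "1/2::real"], of "K p * p x / cmod l"]
      by (simp add: mult.commute)
    obtain y where y: "\<And>p. p \<in> P \<Longrightarrow> (\<lambda>n. p (y - ?s n)) \<longlonglongrightarrow> 0"
      using absolutely_summable_convergent[OF vs P complete, of g a] a g_sums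
      by (meson sums_summable)
    have A_s: "?A (?s n) = x - scl (1 / l ^ n) ((T ^^ n) x)" for n
    proof (induction n)
      case (Suc n)
      have "?A (a n) = scl (1 / l ^ n) ((T ^^ n) x) - scl (1 / l ^ Suc n) ((T ^^ Suc n) x)"
        using l0 by (simp add: a_def T.scale)
      moreover have "?A (?s (Suc n)) = ?A (?s n) + ?A (a n)"
        by (simp add: T.add T.vs1.scale_right_distrib algebra_simps)
      ultimately show ?case using Suc by simp
    qed simp
    have "p (?A y - x) = 0" if p: "p \<in> P" for p
    proof -
      interpret seminormed_space scl p by unfold_locales (rule P[OF p])
      obtain c where c: "c > 0" "\<And>x. p (T x) \<le> c * p x"
        using T p unfolding quotient_bounded_def by blast
      have "p (?A y - x) \<le> (cmod l + c) * p (y - ?s n) + K p * (1/2) ^ n * p x" for n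
      proof -
        have "?A y - x = ?A (y - ?s n) - scl (1 / l ^ n) ((T ^^ n) x)"
          using A_s[of n] by (simp add: T.diff T.vs1.scale_right_diff_distrib algebra_simps)
        then have "p (?A y - x) \<le> p (?A (y - ?s n)) + p (scl (1 / l ^ n) ((T ^^ n) x))"
          by (simp only: triangle_diff)
        also have "p (?A (y - ?s n)) \<le> cmod l * p (y - ?s n) + c * p (y - ?s n)"
          using triangle_diff[of "scl l (y - ?s n)" "T (y - ?s n)"] c(2)[of "y - ?s n"] by simp
        finally show ?thesis using powers[OF p, of n x] by (simp add: algebra_simps)
      qed
      moreover have "(\<lambda>n. (cmod l + c) * p (y - ?s n) + K p * (1/2) ^ n * p x)
          \<longlonglongrightarrow> (cmod l + c) * 0 + K p * 0 * p x"
        by (intro tendsto_intros y[OF p] LIMSEQ_power_zero) auto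
      ultimately have "p (?A y - x) \<le> 0" using LIMSEQ_le_const by fastforce
      then show ?thesis using nonneg[of "?A y - x"] by linarith
    qed
    then have "?A y = x" using separate[of "?A y - x"] by simp
    moreover have "p y \<le> K p / r * p x" if p: "p \<in> P" for p
    proof -
      interpret seminormed_space scl p by unfold_locales (rule P[OF p])
      have "p y \<le> suminf (g p)"
        using a[OF p] g_sums y[OF p] by (rule bound_of_series[OF _ sums_summable])
      also have "\<dots> = (K p * p x) / (cmod l / 2)" using sums_unique[OF g_sums, of p] by (simp add: mult.commute)
      also have "\<dots> \<le> (K p * p x) / r"
        using l r K_pos[OF p] by (intro divide_left_mono mult_nonneg_nonneg mult_pos_pos) auto
      finally show ?thesis by simp
    qed
    ultimately show ?thesis by blast
  qed
  then obtain R where AR: "\<And>x. ?A (R x) = x" and R: "\<And>p x. p \<in> P \<Longrightarrow> p (R x) \<le> K p / r * p x"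
    by metis
  have inj: "y = 0" if Ay: "?A y = 0" for y
  proof (rule separate)
    fix p assume p: "p \<in> P"
    interpret seminormed_space scl p by unfold_locales (rule P[OF p])
    have "T y = scl l y" using Ay by simp
    then have "(T ^^ n) y = scl (l ^ n) y" for n
      by (induction n) (auto simp: T.scale mult.commute)
    then have "p y \<le> K p * (1/2) ^ n * p y" for n using powers[OF p, of n y] l0 by simp
    moreover have "(\<lambda>n. K p * (1/2) ^ n * p y) \<longlonglongrightarrow> K p * 0 * p y"
      by (intro tendsto_intros LIMSEQ_power_zero) auto
    ultimately have "p y \<le> 0" using LIMSEQ_le_const by fastforce
    then show "p y = 0" using nonneg[of y] by linarith
  qed
  have RI: "R x = y" if "?A y = x" for x y
    using inj[of "R x - y"] AR[of x] that
    by (simp add: T.diff T.vs1.scale_right_diff_distrib algebra_simps)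
  have "Vector_Spaces.linear scl scl R"
    unfolding Vector_Spaces.linear_iff
  proof (intro conjI allI vs)
    show "R (x + y) = R x + R y" for x y
      using AR[of x] AR[of y] by (intro RI) (simp add: T.add T.vs1.scale_right_distrib algebra_simps)
    show "R (scl c x) = scl c (R x)" for c x
    proof (rule RI)
      have "?A (scl c (R x)) = scl c (?A (R x))"
        by (simp add: T.scale T.vs1.scale_right_diff_distrib mult.commute)
      then show "?A (scl c (R x)) = scl c x" by (simp only: AR)
    qed
  qed
  moreover have "\<exists>c>0. \<forall>x. p (R x) \<le> c * p x" if "p \<in> P" for p
    using R[OF that] K_pos[OF that] r by (intro exI[of _ "K p / r"]) auto
  ultimately have "R \<in> quotient_bounded scl P" by (simp add: quotient_bounded_def)
  moreover have "R \<circ> (op_scale scl l id - T) = id" "(op_scale scl l id - T) \<circ> R = id"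
    using RI AR by (auto simp: fun_eq_iff op_scale_def)
  ultimately show ?thesis using R by blast
qed

section \<open>Regular and bounded elements\<close>

lemma op_scale_funpow:
  assumes "Vector_Spaces.linear scl scl T"
  shows "(op_scale scl a T ^^ n) x = scl (a ^ n) ((T ^^ n) x)"
proof -
  interpret Vector_Spaces.linear scl scl T by fact
  show ?thesis by (induction n) (auto simp: op_scale_def scale)
qed

lemma id_quotient_bounded: "vector_space scl \<Longrightarrow> id \<in> quotient_bounded scl P"
  unfolding quotient_bounded_def
  by (auto simp: vector_space.linear_id intro: exI[of _ 1])

text \<open>The scalar \<open>1 / (2 t)\<close> works for every seminorm, since \<open>2 t\<close> is a rate of growth of the powers
  that exceeds \<open>t\<close>.\<close>

lemma regular_imp_bounded_element:
  assumes vs: "vector_space scl" and P: "\<And>p. p \<in> P \<Longrightarrow> seminorm scl p"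
    and reg: "regular_op scl P T"
  shows "T \<in> bounded_elements scl P"
proof -
  interpret vector_space scl by fact
  let ?R = "\<lambda>l. resolvent scl l T"
  obtain t where T: "T \<in> quotient_bounded scl P" and t: "t > 0"
    and invertible: "\<And>l. cmod l > t \<Longrightarrow> qb_invertible scl P (op_scale scl l id - T)"
    and bdd: "qb_bounded scl P {?R l | l. cmod l > t}"
    using reg unfolding regular_op_def by blast
  have lin: "Vector_Spaces.linear scl scl T" using T by (rule quotient_bounded_linear)
  have R: "?R l \<in> quotient_bounded scl P" "?R l (scl l x - T x) = x" "scl l (?R l x) - T (?R l x) = x"
    if l: "cmod l > t" for l x
  proof -
    obtain S where S: "S \<in> quotient_bounded scl P"
      "S \<circ> (op_scale scl l id - T) = id" "(op_scale scl l id - T) \<circ> S = id"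
      using invertible[OF l] unfolding qb_invertible_def by blast
    have "?R l = S" unfolding resolvent_def using S(3,2) by (rule inv_unique_comp)
    then show "?R l \<in> quotient_bounded scl P" "?R l (scl l x - T x) = x"
      "scl l (?R l x) - T (?R l x) = x"
      using S(1) S(2,3)[THEN fun_cong, of x] by (simp_all add: op_scale_def)
  qed
  define \<alpha> :: complex where "\<alpha> = of_real (1 / (2 * t))"
  let ?B = "{op_scale scl \<alpha> T ^^ n | n. n \<ge> 1}"
  have bound: "\<exists>K>0. \<forall>n x. p ((op_scale scl \<alpha> T ^^ n) x) \<le> K * p x" if p: "p \<in> P" for p
  proof -
    obtain c where c: "c > 0" "\<And>x. p (T x) \<le> c * p x"
      using T p unfolding quotient_bounded_def by blast
    have "\<exists>M>0. \<forall>S\<in>{?R l | l. cmod l > t}. \<forall>x. p (S x) \<le> M * p x"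
      using vs P bdd p by (rule qb_boundedD)
    then obtain M where "M > 0" and "\<forall>S\<in>{?R l | l. cmod l > t}. \<forall>x. p (S x) \<le> M * p x"
      by (elim exE conjE) (rule that)
    then have M: "M > 0" "\<And>l x. cmod l > t \<Longrightarrow> p (?R l x) \<le> M * p x" by blast+
    interpret bounded_resolvent scl p T ?R c t M
      by (intro bounded_resolvent.intro seminormed_space.intro seminormed_space_axioms.intro
            bounded_resolvent_axioms.intro)
         (rule vs P[OF p] lin c M t R(2,3) quotient_bounded_linear[OF R(1)] | assumption)+
    obtain K where K: "\<And>n x. p ((T ^^ n) x) \<le> K * (2 * t) ^ n * p x"
      using power_bound_beyond_t[of "2 * t"] t by auto
    have "p ((op_scale scl \<alpha> T ^^ n) x) \<le> max K 1 * p x" for n x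
    proof -
      have "p ((op_scale scl \<alpha> T ^^ n) x) = p ((T ^^ n) x) / (2 * t) ^ n"
        using t by (simp add: op_scale_funpow[OF lin] \<alpha>_def norm_power norm_divide norm_mult power_divide)
      also have "\<dots> \<le> K * p x"
        using K[of n x] t by (simp add: pos_divide_le_eq mult_ac)
      also have "\<dots> \<le> max K 1 * p x" by (intro mult_right_mono) auto
      finally show ?thesis .
    qed
    then show ?thesis by (intro exI[of _ "max K 1"]) auto
  qed
  have "Vector_Spaces.linear scl scl (op_scale scl \<alpha> T ^^ n)" for n
    using module.subspace_scale[OF _ subspace_quotient_bounded[OF vs P] T, of \<alpha>]
      vector_space_op_scale[OF vs]
    by (intro linear_funpow quotient_bounded_linear[of _ _ P]) (simp add: vector_space_def module_def)
  with bound have "op_scale scl \<alpha> T ^^ n \<in> quotient_bounded scl P" for n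
    unfolding quotient_bounded_def by blast
  then have "?B \<subseteq> quotient_bounded scl P" by blast
  moreover have "\<exists>M>0. \<forall>S\<in>?B. \<forall>x. p (S x) \<le> M * p x" if "p \<in> P" for p
    using bound[OF that] by blast
  ultimately have "qb_bounded scl P ?B"
    by (intro qb_boundedI vs P)
  then show ?thesis
    using T t unfolding bounded_elements_def by (auto simp: \<alpha>_def intro!: exI[of _ \<alpha>])
qed

lemma bounded_element_imp_regular:
  assumes vs: "vector_space scl" and P: "\<And>p. p \<in> P \<Longrightarrow> seminorm scl p"
    and complete: "sequentially_complete (seminorm_topology UNIV P)"
    and Hausdorff: "Hausdorff_space (seminorm_topology UNIV P)"
    and bdd: "T \<in> bounded_elements scl P"
  shows "regular_op scl P T"
proof -
  interpret vector_space scl by fact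
  interpret ops: vector_space "op_scale scl" using vs by (rule vector_space_op_scale)
  have sub: "ops.subspace (quotient_bounded scl P)" using vs P by (rule subspace_quotient_bounded)
  obtain \<alpha> where T: "T \<in> quotient_bounded scl P" and \<alpha>: "\<alpha> \<noteq> 0"
    and powers: "qb_bounded scl P {op_scale scl \<alpha> T ^^ n | n. n \<ge> 1}"
    using bdd unfolding bounded_elements_def by blast
  have "\<exists>M>0. \<forall>n\<ge>1. \<forall>x. p ((op_scale scl \<alpha> T ^^ n) x) \<le> M * p x" if p: "p \<in> P" for p
  proof -
    have "\<exists>M>0. \<forall>S\<in>{op_scale scl \<alpha> T ^^ n | n. n \<ge> 1}. \<forall>x. p (S x) \<le> M * p x"
      using vs P powers p by (rule qb_boundedD)
    then obtain M where "M > 0" and M: "\<forall>S\<in>{op_scale scl \<alpha> T ^^ n | n. n \<ge> 1}. \<forall>x. p (S x) \<le> M * p x"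
      by (elim exE conjE) (rule that)
    have "p ((op_scale scl \<alpha> T ^^ n) x) \<le> M * p x" if "n \<ge> 1" for n x
      by (rule M[rule_format]) (use that in blast)
    with \<open>M > 0\<close> show ?thesis by blast
  qed
  then obtain M where M: "\<And>p. p \<in> P \<Longrightarrow> M p > 0"
    "\<And>p n x. p \<in> P \<Longrightarrow> n \<ge> 1 \<Longrightarrow> p ((op_scale scl \<alpha> T ^^ n) x) \<le> M p * p x"
    by metis
  define r where "r = 1 / cmod \<alpha>"
  define K where "K p = max (M p) 1" for p
  have r: "r > 0" using \<alpha> by (simp add: r_def)
  have K: "p ((T ^^ n) x) \<le> K p * r ^ n * p x" if p: "p \<in> P" for p n x
  proof -
    interpret seminormed_space scl p by unfold_locales (rule P[OF p])
    have "p ((op_scale scl \<alpha> T ^^ n) x) \<le> K p * p x"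
    proof (cases "n = 0")
      case True
      have "1 * p x \<le> K p * p x" unfolding K_def by (intro mult_right_mono) auto
      with True show ?thesis by simp
    next
      case False
      then have "p ((op_scale scl \<alpha> T ^^ n) x) \<le> M p * p x" using M(2)[OF p, of n] by simp
      also have "\<dots> \<le> K p * p x" unfolding K_def by (intro mult_right_mono) auto
      finally show ?thesis .
    qed
    then have "cmod \<alpha> ^ n * p ((T ^^ n) x) \<le> K p * p x"
      by (simp add: op_scale_funpow[OF quotient_bounded_linear[OF T]] norm_power)
    then show ?thesis using \<alpha> by (simp add: r_def power_divide field_simps)
  qed
  have "K p > 0" for p by (simp add: K_def)
  note Neumann = Neumann_resolvent[OF vs P complete Hausdorff T K this r]
  have inverse: "qb_invertible scl P (op_scale scl l id - T) \<and> resolvent scl l T \<in> quotient_bounded scl P \<and>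
      (\<forall>p\<in>P. \<forall>x. p (resolvent scl l T x) \<le> K p / r * p x)" if l: "cmod l > 2 * r" for l
  proof -
    obtain R where R: "R \<in> quotient_bounded scl P"
      "R \<circ> (op_scale scl l id - T) = id" "(op_scale scl l id - T) \<circ> R = id"
      "\<forall>p\<in>P. \<forall>x. p (R x) \<le> K p / r * p x"
      using Neumann[of l] l by auto
    have "op_scale scl l id - T \<in> quotient_bounded scl P"
      by (intro ops.subspace_diff[OF sub] ops.subspace_scale[OF sub] T id_quotient_bounded[OF vs])
    moreover have "resolvent scl l T = R"
      unfolding resolvent_def using R(3,2) by (rule inv_unique_comp)
    ultimately show ?thesis using R unfolding qb_invertible_def by blast
  qed
  have "qb_bounded scl P {resolvent scl l T | l. cmod l > 2 * r}"
  proof (rule qb_boundedI[OF vs])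
    show "seminorm scl p" if "p \<in> P" for p
      using that by (rule P)
    show "{resolvent scl l T | l. cmod l > 2 * r} \<subseteq> quotient_bounded scl P"
      using inverse by blast
    show "\<exists>M>0. \<forall>S\<in>{resolvent scl l T | l. cmod l > 2 * r}. \<forall>x. p (S x) \<le> M * p x" if "p \<in> P" for p
      using inverse that r by (intro exI[of _ "K p / r"]) (auto simp: K_def)
  qed
  with inverse T r show ?thesis
    unfolding regular_op_def by (intro conjI exI[of _ "2 * r"]) auto
qed

theorem proposition2p3:
  fixes scl :: "complex \<Rightarrow> 'a::ab_group_add \<Rightarrow> 'a"
    and \<tau> :: "'a topology"
    and P :: "('a \<Rightarrow> real) set"
    and T :: "'a \<Rightarrow> 'a"
  assumes "locally_convex_space scl \<tau>"
    and "Hausdorff_space \<tau>"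
    and "sequentially_complete \<tau>"
    and "calibration scl \<tau> P"
    and "T \<in> quotient_bounded scl P"
  shows "regular_op scl P T \<longleftrightarrow> T \<in> bounded_elements scl P"
proof -
  have vs: "vector_space scl"
    using assms(1) by (simp add: locally_convex_space_def linear_topology_def)
  have P: "seminorm scl p" if "p \<in> P" for p
    using assms(4) that by (simp add: calibration_def)
  have \<tau>: "\<tau> = seminorm_topology UNIV P"
    using assms(4) by (simp add: calibration_def)
  show ?thesis
    using regular_imp_bounded_element[OF vs P]
      bounded_element_imp_regular[OF vs P assms(3)[unfolded \<tau>] assms(2)[unfolded \<tau>]]
    by blast
qed

end
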